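(* Let $M=\sum_{k=1}^\infty\sigma_kB^{H_k}$ be the multi-mixed fractional Brownian motion with parameters $\sigma_k,H_k$, $k\in\mathbb{N}$, let $\lambda>0$, and let $U$ be the multi-mixed fractional Ornstein--Uhlenbeck process with parameter $\lambda$, i.e. the stationary solution of the Langevin equation $\mathrm{d}U_t=-\lambda U_t\,\mathrm{d}t+\mathrm{d}M_t$. Then, on $L^2(\Omega\times[0,T])$, $U$ can be represented as the integral $$U_t=\mathrm{e}^{-\lambda t}\xi+\int_0^t\mathrm{e}^{-\lambda(t-s)}\,\mathrm{d}M_s,$$ where the integral is understood in the integration-by-parts sense, and $$\xi=\int_{-\infty}^0\mathrm{e}^{\lambda s}\,\mathrm{d}M_s,$$ where $(M_s)_{s\le0}$ is an independent copy of the multi-mixed fractional Brownian motion $(M_s)_{s\ge0}$.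
   Context: A fractional Brownian motion (fBm) $B^H=(B^H_t)_{t\ge0}$ with Hurst index $H\in(0,1)$ is a centered Gaussian process with covariance $\frac12\left[t^{2H}+s^{2H}-|t-s|^{2H}\right]$. Multi-mixed fractional Brownian motion (mmfBm): let $\sigma_k>0$, $k\in\mathbb{N}$, satisfy $\sum_{k=1}^\infty\sigma_k^2<\infty$, and let $H_k\in(0,1)$, $k\in\mathbb{N}$, satisfy $H_k\ne H_l$ for $k\ne l$, $\inf_kH_k>0$ and $\sup_kH_k<1$. The mmfBm is $M=\sum_{k=1}^\infty\sigma_kB^{H_k}$, where $B^{H_k}$, $k\in\mathbb{N}$, are independent fBm's; the series converges in $L^2(\Omega\times[0,T])$ for all $T>0$, and in $L^2(\Omega)$ for each fixed $t\ge0$. The Langevin equation is understood in the integration-by-parts sense; for the integral this means $\int_0^t\mathrm{e}^{\lambda s}\,\mathrm{d}M_s=\mathrm{e}^{\lambda t}M_t-\lambda\int_0^t\mathrm{e}^{\lambda s}M_s\,\mathrm{d}s$.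
   Formalization: Independence of (M_s) for s≤0 from (M_s) for s≥0 is dropped (it contradicts stationarity of U); the past need only be a copy in law, and U is taken as the stationary solution of the Langevin equation on the whole real line. *)

theory Defs
  imports "HOL-Probability.Probability"
begin

text \<open>Processes are functions \<open>X t \<omega>\<close> of time and sample point.\<close>

definition sq_integrable :: "'b measure \<Rightarrow> ('b \<Rightarrow> real) \<Rightarrow> bool" where
  "sq_integrable N f \<longleftrightarrow> f \<in> borel_measurable N \<and> integrable N (\<lambda>x. (f x)\<^sup>2)"

definition L2_eq :: "'b measure \<Rightarrow> ('b \<Rightarrow> real) \<Rightarrow> ('b \<Rightarrow> real) \<Rightarrow> bool" where
  "L2_eq N f g \<longleftrightarrow> sq_integrable N f \<and> sq_integrable N g \<and> (AE x in N. f x = g x)"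

definition L2_tendsto :: "'b measure \<Rightarrow> ('i \<Rightarrow> 'b \<Rightarrow> real) \<Rightarrow> ('b \<Rightarrow> real) \<Rightarrow> 'i filter \<Rightarrow> bool" where
  "L2_tendsto N X Y F \<longleftrightarrow>
     (\<forall>\<^sub>F i in F. sq_integrable N (X i)) \<and> sq_integrable N Y \<and>
     ((\<lambda>i. \<integral>x. (X i x - Y x)\<^sup>2 \<partial>N) \<longlongrightarrow> 0) F"

abbreviation time_product :: "'a measure \<Rightarrow> real \<Rightarrow> ('a \<times> real) measure" where
  "time_product P T \<equiv> P \<Otimes>\<^sub>M restrict_space lborel {0..T}"

definition measurable_process :: "'a measure \<Rightarrow> (real \<Rightarrow> 'a \<Rightarrow> real) \<Rightarrow> bool" where
  "measurable_process P X \<longleftrightarrow> (\<lambda>(\<omega>, t). X t \<omega>) \<in> borel_measurable (P \<Otimes>\<^sub>M borel)"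

definition process_law :: "'a measure \<Rightarrow> real set \<Rightarrow> (real \<Rightarrow> 'a \<Rightarrow> real) \<Rightarrow> (real \<Rightarrow> real) measure" where
  "process_law P I X = distr P (PiM I (\<lambda>_. borel)) (\<lambda>\<omega>. \<lambda>t\<in>I. X t \<omega>)"

text \<open>The point mass at 0 counts as a (degenerate) centered Gaussian law.\<close>

definition centered_gaussian :: "'a measure \<Rightarrow> ('a \<Rightarrow> real) \<Rightarrow> bool" where
  "centered_gaussian P X \<longleftrightarrow> X \<in> borel_measurable P \<and>
     ((AE \<omega> in P. X \<omega> = 0) \<or> (\<exists>s>0. distributed P lborel X (normal_density 0 s)))"

definition centered_gaussian_process :: "'a measure \<Rightarrow> real set \<Rightarrow> (real \<Rightarrow> 'a \<Rightarrow> real) \<Rightarrow> bool" where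
  "centered_gaussian_process P I X \<longleftrightarrow>
     (\<forall>J c. finite J \<and> J \<subseteq> I \<longrightarrow> centered_gaussian P (\<lambda>\<omega>. \<Sum>t\<in>J. c t * X t \<omega>))"

definition fBm :: "'a measure \<Rightarrow> real \<Rightarrow> (real \<Rightarrow> 'a \<Rightarrow> real) \<Rightarrow> bool" where
  "fBm P H B \<longleftrightarrow> centered_gaussian_process P {0..} B \<and>
     (\<forall>s\<ge>0. \<forall>t\<ge>0. (\<integral>\<omega>. B s \<omega> * B t \<omega> \<partial>P) =
        (t powr (2 * H) + s powr (2 * H) - \<bar>t - s\<bar> powr (2 * H)) / 2)"

text \<open>Only times \<open>t \<ge> 0\<close> of \<open>M\<close> are constrained.  The summands are indexed from 0.\<close>

definition mmfBm ::
  "'a measure \<Rightarrow> (nat \<Rightarrow> real) \<Rightarrow> (nat \<Rightarrow> real) \<Rightarrow> (real \<Rightarrow> 'a \<Rightarrow> real) \<Rightarrow> bool" where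
  "mmfBm P \<sigma> H M \<longleftrightarrow> (\<exists>B :: nat \<Rightarrow> real \<Rightarrow> 'a \<Rightarrow> real.
     (\<forall>k. fBm P (H k) (B k)) \<and>
     prob_space.indep_vars P (\<lambda>k. PiM {0..} (\<lambda>_. borel)) (\<lambda>k \<omega>. \<lambda>t\<in>{0..}. B k t \<omega>) UNIV \<and>
     (\<forall>t\<ge>0. L2_tendsto P (\<lambda>n \<omega>. \<Sum>k<n. \<sigma> k * B k t \<omega>) (M t) sequentially) \<and>
     (\<forall>T>0. L2_tendsto (time_product P T)
        (\<lambda>n (\<omega>, t). \<Sum>k<n. \<sigma> k * B k t \<omega>) (\<lambda>(\<omega>, t). M t \<omega>) sequentially))"

text \<open>The integral \<open>\<integral>\<^sub>a\<^sup>b f(s) dM\<^sub>s\<close> by parts.  For \<open>a = 0\<close> the lower boundary term vanishes almost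
  surely when \<open>M\<close> is an mmfBm, because then \<open>M\<^sub>0 = 0\<close> almost surely.\<close>

definition ibp_integral ::
  "(real \<Rightarrow> real) \<Rightarrow> (real \<Rightarrow> 'a \<Rightarrow> real) \<Rightarrow> real \<Rightarrow> real \<Rightarrow> 'a \<Rightarrow> real" where
  "ibp_integral f M a b \<omega> = f b * M b \<omega> - f a * M a \<omega> - (LBINT s=a..b. deriv f s * M s \<omega>)"

text \<open>\<open>(M\<^sub>s)\<^sub>s\<^sub>\<le>\<^sub>0\<close> is a copy of \<open>(M\<^sub>s)\<^sub>s\<^sub>\<ge>\<^sub>0\<close>: time-reversed, it has the same law.  The joint law of
  the two halves is left free.  It must not be fixed by independence: if \<open>M\<close> is an mmfBm and \<open>U\<close>
  solves the Langevin equation with \<open>U\<^sub>0\<close> square integrable and independent of \<open>(M\<^sub>s)\<^sub>s\<^sub>\<ge>\<^sub>0\<close>, then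
  \<open>U\<close> is not stationary.  The two-sided mmfBm (each fBm extended to the real line
  with stationary increments) is an instance for which a stationary solution exists.\<close>

definition past_is_copy :: "'a measure \<Rightarrow> (real \<Rightarrow> 'a \<Rightarrow> real) \<Rightarrow> bool" where
  "past_is_copy P M \<longleftrightarrow> process_law P {0..} (\<lambda>s. M (- s)) = process_law P {0..} M"

definition stationary_process :: "'a measure \<Rightarrow> (real \<Rightarrow> 'a \<Rightarrow> real) \<Rightarrow> bool" where
  "stationary_process P U \<longleftrightarrow> (\<forall>h. process_law P UNIV (\<lambda>t. U (t + h)) = process_law P UNIV U)"

text \<open>The Langevin equation on the whole real line.  The identity is required almost surely for
  each pair of times, since \<open>M\<close> is determined only up to modification.\<close>

definition langevin_solution ::
  "'a measure \<Rightarrow> real \<Rightarrow> (real \<Rightarrow> 'a \<Rightarrow> real) \<Rightarrow> (real \<Rightarrow> 'a \<Rightarrow> real) \<Rightarrow> bool" where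
  "langevin_solution P lam M U \<longleftrightarrow> measurable_process P U \<and>
     (\<forall>a b. AE \<omega> in P. set_integrable lborel {a..b} (\<lambda>s. U s \<omega>)) \<and>
     (\<forall>s t. s \<le> t \<longrightarrow> (AE \<omega> in P.
        U t \<omega> - U s \<omega> = - lam * (LBINT u=s..t. U u \<omega>) + ibp_integral (\<lambda>_. 1) M s t \<omega>))"

definition mmfOU ::
  "'a measure \<Rightarrow> real \<Rightarrow> (real \<Rightarrow> 'a \<Rightarrow> real) \<Rightarrow> (real \<Rightarrow> 'a \<Rightarrow> real) \<Rightarrow> bool" where
  "mmfOU P lam M U \<longleftrightarrow> langevin_solution P lam M U \<and> stationary_process P U"

end

theory Submission
  imports Defs
begin

text \<open>Multiplying the Langevin equation by the integrating factor \<open>exp (\<lambda> t)\<close> gives, almost surely for each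
  \<open>s \<le> t\<close>, \<open>exp (\<lambda> t) * U t = exp (\<lambda> s) * U s + \<integral>\<^sub>s\<^sup>t exp (\<lambda> r) dM\<^sub>r\<close>.  Taking \<open>t = 0\<close>, the integral from \<open>a\<close> to
  \<open>0\<close> differs from \<open>U 0\<close> by \<open>exp (\<lambda> a) * U a\<close>, which by stationarity tends to 0 in \<open>L\<^sup>2\<close> as \<open>a \<rightarrow> -\<infinity>\<close> as
  soon as \<open>U 0\<close> is square integrable; hence \<open>\<xi> = U 0\<close>.  Square integrability is not assumed: the
  integrals are bounded in \<open>L\<^sup>2\<close> because the variance of \<open>M\<close> grows at most quadratically, and
  \<open>exp (\<lambda> a) * U a\<close> tends to 0 in probability by stationarity, so a truncation argument bounds the
  second moment of \<open>U 0\<close>.\<close>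

section \<open>The integrating factor along a single path\<close>

lemma set_lebesgue_integral_exp:
  fixes a b c :: real
  assumes "a \<le> b" "c \<noteq> 0"
  shows "set_integrable lborel {a..b} (\<lambda>x. exp (c * x))"
    and "(LINT x:{a..b}|lborel. exp (c * x)) = (exp (c * b) - exp (c * a)) / c"
proof -
  have d: "((\<lambda>x. exp (c * x) / c) has_real_derivative exp (c * x)) (at x)" for x
    using \<open>c \<noteq> 0\<close> by (auto intro!: derivative_eq_intros)
  have "has_bochner_integral lborel (\<lambda>x. indicator {a..b} x *\<^sub>R exp (c * x))
    (exp (c * b) / c - exp (c * a) / c)"
    using d by (intro has_bochner_integral_FTC_Icc \<open>a \<le> b\<close>)
      (auto intro!: continuous_intros simp: has_real_derivative_iff_has_vector_derivative[symmetric]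
        intro: has_field_derivative_at_within)
  then show "set_integrable lborel {a..b} (\<lambda>x. exp (c * x))"
    and "(LINT x:{a..b}|lborel. exp (c * x)) = (exp (c * b) - exp (c * a)) / c"
    by (auto simp: set_integrable_def set_lebesgue_integral_def has_bochner_integral_iff
        diff_divide_distrib)
qed

lemma integrable_pair_mult:
  fixes f g :: "real \<Rightarrow> real"
  assumes "integrable lborel f" "integrable lborel g"
  shows "integrable (lborel \<Otimes>\<^sub>M lborel) (\<lambda>(x, y). f x * g y)"
proof -
  note [measurable] = borel_measurable_integrable[OF assms(1)] borel_measurable_integrable[OF assms(2)]
  show ?thesis
    using assms by (intro lborel_pair.Fubini_integrable) (auto simp: abs_mult)
qed

text \<open>Integration by parts for the exponential against the primitive of \<open>u\<close>. As
  \<open>u\<close> is only integrable, the identity comes from Fubini on the triangle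
  \<open>s \<le> q \<le> r \<le> t\<close> and not from differentiating the primitive.\<close>

lemma Fubini_exp_primitive:
  fixes u :: "real \<Rightarrow> real" and s t c :: real
  assumes st: "s \<le> t" and c: "c \<noteq> 0" and u: "set_integrable lborel {s..t} u"
  shows "set_integrable lborel {s..t} (\<lambda>r. exp (c * r) * (LINT q:{s..r}|lborel. u q))" (is ?int)
    and "c * (LINT r:{s..t}|lborel. exp (c * r) * (LINT q:{s..r}|lborel. u q)) =
      exp (c * t) * (LINT q:{s..t}|lborel. u q) - (LINT q:{s..t}|lborel. exp (c * q) * u q)" (is ?eq)
    and "set_integrable lborel {s..t} (\<lambda>q. exp (c * q) * u q)" (is ?int')
proof -
  define v where "v q = indicator {s..t} q * u q" for q
  have v: "integrable lborel v"
    using u by (simp add: v_def[abs_def] set_integrable_def)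
  note [measurable] = borel_measurable_integrable[OF v]
  define e where "e r = indicator {s..t} r * exp (c * r)" for r
  have e: "integrable lborel e"
    using set_lebesgue_integral_exp(1)[OF st c] by (simp add: e_def[abs_def] set_integrable_def)
  note [measurable] = borel_measurable_integrable[OF e]
  have e_le: "\<bar>e r\<bar> \<le> exp (\<bar>c\<bar> * (\<bar>s\<bar> + \<bar>t\<bar>))" for r
  proof -
    have "c * r \<le> \<bar>c\<bar> * (\<bar>s\<bar> + \<bar>t\<bar>)" if "r \<in> {s..t}"
      using that by (intro order_trans[OF abs_ge_self[of "c * r"]]) (auto simp: abs_mult intro!: mult_left_mono)
    then show ?thesis by (auto simp: e_def indicator_def)
  qed
  \<comment> \<open>Both \<open>e\<close> and \<open>v\<close> carry the indicator of
    \<open>{s..t}\<close>, so \<open>f\<close> is supported on the triangle. Its row integrals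
    produce the left-hand side of the identity, its column integrals the right-hand side.\<close>
  define f where "f = (\<lambda>(r, q). (if q \<le> r then e r * v q else 0))"
  have [measurable]: "f \<in> borel_measurable (lborel \<Otimes>\<^sub>M lborel)"
    unfolding f_def by measurable
  have f: "integrable (lborel \<Otimes>\<^sub>M lborel) f"
    by (rule Bochner_Integration.integrable_bound[OF integrable_pair_mult[OF e v]])
      (auto simp: f_def)
  have row: "(\<integral>q. f (r, q) \<partial>lborel) =
      indicator {s..t} r * (exp (c * r) * (LINT q:{s..r}|lborel. u q))" for r
  proof -
    have "(\<integral>q. f (r, q) \<partial>lborel) = (\<integral>q. e r * (indicator {s..r} q * u q) \<partial>lborel)"
      by (intro Bochner_Integration.integral_cong) (auto simp: f_def e_def v_def indicator_def)
    then show ?thesis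
      by (simp add: e_def set_lebesgue_integral_def)
  qed
  have col: "c * (\<integral>r. f (r, q) \<partial>lborel) =
      exp (c * t) * v q - indicator {s..t} q * (exp (c * q) * u q)" for q
  proof (cases "q \<in> {s..t}")
    case True
    have "(\<integral>r. f (r, q) \<partial>lborel) = (\<integral>r. u q * (indicator {q..t} r * exp (c * r)) \<partial>lborel)"
      using True by (intro Bochner_Integration.integral_cong) (auto simp: f_def e_def v_def indicator_def)
    also have "\<dots> = u q * ((exp (c * t) - exp (c * q)) / c)"
      using set_lebesgue_integral_exp(2)[of q t c] True c by (simp add: set_lebesgue_integral_def)
    finally show ?thesis
      using True c by (simp add: v_def field_simps)
  next
    case False
    then have "(\<lambda>r. f (r, q)) = (\<lambda>r. 0)"
      by (auto simp: f_def v_def)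
    with False show ?thesis by (simp add: v_def)
  qed
  show ?int
    using lborel_pair.integrable_fst'[OF f] by (simp add: row set_integrable_def)
  have "integrable lborel (\<lambda>q. e q * v q)"
  proof (rule Bochner_Integration.integrable_bound)
    show "integrable lborel (\<lambda>q. exp (\<bar>c\<bar> * (\<bar>s\<bar> + \<bar>t\<bar>)) * v q)"
      using v by simp
    show "AE q in lborel. norm (e q * v q) \<le> norm (exp (\<bar>c\<bar> * (\<bar>s\<bar> + \<bar>t\<bar>)) * v q)"
      using e_le by (auto simp: abs_mult intro!: mult_right_mono)
  qed measurable
  moreover have "e q * v q = indicator {s..t} q * (exp (c * q) * u q)" for q
    by (simp add: e_def v_def indicator_def)
  ultimately have w: "integrable lborel (\<lambda>q. indicator {s..t} q * (exp (c * q) * u q))"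
    by simp
  then show ?int' by (simp add: set_integrable_def)
  have "c * (LINT r:{s..t}|lborel. exp (c * r) * (LINT q:{s..r}|lborel. u q)) =
      c * (\<integral>r. (\<integral>q. f (r, q) \<partial>lborel) \<partial>lborel)"
    by (simp add: row set_lebesgue_integral_def)
  also have "\<dots> = (\<integral>q. c * (\<integral>r. f (r, q) \<partial>lborel) \<partial>lborel)"
    using lborel_pair.Fubini_integral[of "\<lambda>r q. f (r, q)"] f by simp
  also have "\<dots> = (\<integral>q. exp (c * t) * v q \<partial>lborel) -
      (\<integral>q. indicator {s..t} q * (exp (c * q) * u q) \<partial>lborel)"
    unfolding col using v w by (intro Bochner_Integration.integral_diff) auto
  finally show ?eq
    by (simp add: v_def set_lebesgue_integral_def)
qed

text \<open>Variation of constants for one path. The equation holds only for almost every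
  \<open>r\<close>, so nothing is differentiated: solved for \<open>m r\<close> and integrated
  against \<open>exp (c * r)\<close>, it leaves an iterated integral of \<open>u\<close>, which the
  Fubini identity eliminates. The endpoint \<open>t\<close> is a null set, so the equation there is
  a separate assumption.\<close>

lemma integrating_factor:
  fixes u m :: "real \<Rightarrow> real" and s t c :: real
  assumes st: "s \<le> t" and c: "c \<noteq> 0"
    and [measurable]: "m \<in> borel_measurable borel"
    and u: "set_integrable lborel {s..t} u"
    and ae: "AE r in lborel. r \<in> {s..t} \<longrightarrow>
      u r - u s = - c * (LINT q:{s..r}|lborel. u q) + (m r - m s)"
    and at_t: "u t - u s = - c * (LINT q:{s..t}|lborel. u q) + (m t - m s)"
  shows "exp (c * t) * u t - exp (c * s) * u s =
    exp (c * t) * m t - exp (c * s) * m s - c * (LINT r:{s..t}|lborel. exp (c * r) * m r)"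
proof -
  define Z where "Z r = (LINT q:{s..r}|lborel. u q)" for r
  define I where "I f = (LINT r:{s..t}|lborel. exp (c * r) * f r)" for f :: "real \<Rightarrow> real"
  note F = Fubini_exp_primitive[OF st c u, folded Z_def]
  note E = set_lebesgue_integral_exp[OF st c]
  have int: "set_integrable lborel {s..t} (\<lambda>r. (m s - u s) * exp (c * r))"
    using E(1) by simp
  have cZ: "set_integrable lborel {s..t} (\<lambda>r. c * (exp (c * r) * Z r))"
    using F(1) by simp
  have "I m = (LINT r:{s..t}|lborel. exp (c * r) * u r + (m s - u s) * exp (c * r) + c * (exp (c * r) * Z r))"
    unfolding I_def set_lebesgue_integral_def
  proof (rule integral_cong_AE)
    show "(\<lambda>r. indicator {s..t} r *\<^sub>R (exp (c * r) * u r + (m s - u s) * exp (c * r) + c * (exp (c * r) * Z r)))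
        \<in> borel_measurable lborel"
      using F(3) int cZ unfolding set_integrable_def scaleR_add_right
      by (intro borel_measurable_add borel_measurable_integrable)
    show "AE r in lborel. indicator {s..t} r *\<^sub>R (exp (c * r) * m r) =
        indicator {s..t} r *\<^sub>R (exp (c * r) * u r + (m s - u s) * exp (c * r) + c * (exp (c * r) * Z r))"
      using ae
    proof eventually_elim
      case (elim r)
      show ?case
      proof (cases "r \<in> {s..t}")
        case True
        then have mr: "m r = u r + (m s - u s) + c * Z r"
          using elim by (simp add: Z_def)
        show ?thesis unfolding mr by (simp add: algebra_simps)
      qed simp
    qed
  qed measurable
  also have "\<dots> = I u + (m s - u s) * ((exp (c * t) - exp (c * s)) / c) + c * I Z"
    using F(1,3) int by (simp add: set_integral_add I_def E(2))
  finally have "c * I m = c * I u + (m s - u s) * (exp (c * t) - exp (c * s)) + c * (c * I Z)"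
    using c by (simp add: field_simps)
  moreover have "c * I Z = exp (c * t) * Z t - I u"
    using F(2) by (simp add: I_def Z_def)
  moreover have "c * Z t = m t - m s - (u t - u s)"
    using at_t by (simp add: Z_def)
  \<comment> \<open>Inserting the last two identities into the first cancels \<open>c * I u\<close>;
    only boundary values remain.\<close>
  ultimately have I_m: "c * I m = (m s - u s) * (exp (c * t) - exp (c * s)) + exp (c * t) * (m t - m s - (u t - u s))"
  proof -
    assume 1: "c * I m = c * I u + (m s - u s) * (exp (c * t) - exp (c * s)) + c * (c * I Z)"
      and 2: "c * I Z = exp (c * t) * Z t - I u" and 3: "c * Z t = m t - m s - (u t - u s)"
    have "c * (c * I Z) = exp (c * t) * (c * Z t) - c * I u"
      unfolding 2 by (simp add: algebra_simps)
    then show ?thesis unfolding 1 3 by simp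
  qed
  show ?thesis
    unfolding I_m[unfolded I_def] by (simp add: algebra_simps)
qed

section \<open>Second moments of the multi-mixed fractional Brownian motion\<close>

lemma centered_gaussian_moments:
  assumes "prob_space P" and X: "centered_gaussian P X"
  shows "integrable P X" "integrable P (\<lambda>\<omega>. (X \<omega>)\<^sup>2)" "(\<integral>\<omega>. X \<omega> \<partial>P) = 0"
proof -
  interpret prob_space P by fact
  have [measurable]: "X \<in> borel_measurable P"
    using X by (simp add: centered_gaussian_def)
  consider "AE \<omega> in P. X \<omega> = 0" | s where "s > 0" "distributed P lborel X (normal_density 0 s)"
    using X by (auto simp: centered_gaussian_def)
  then have "integrable P X \<and> integrable P (\<lambda>\<omega>. (X \<omega>)\<^sup>2) \<and> (\<integral>\<omega>. X \<omega> \<partial>P) = 0"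
  proof cases
    case 1
    then have "AE \<omega> in P. (X \<omega>)\<^sup>2 = 0"
      by eventually_elim simp
    moreover from 1 have "(\<integral>\<omega>. X \<omega> \<partial>P) = (\<integral>\<omega>. 0 \<partial>P)"
      by (intro integral_cong_AE) auto
    ultimately show ?thesis
      using 1 integrable_cong_AE[of X P "\<lambda>_. 0"] integrable_cong_AE[of "\<lambda>\<omega>. (X \<omega>)\<^sup>2" P "\<lambda>_. 0"] by simp
  next
    case 2
    show ?thesis
      using distributed_integrable[OF 2(2), of "\<lambda>x. x"] integrable_normal_moment[OF 2(1), of 0 1]
        distributed_integrable[OF 2(2), of "\<lambda>x. x\<^sup>2"] integrable_normal_moment[OF 2(1), of 0 2]
        normal_distributed_expectation[OF 2] by simp
  qed
  then show "integrable P X" "integrable P (\<lambda>\<omega>. (X \<omega>)\<^sup>2)" "(\<integral>\<omega>. X \<omega> \<partial>P) = 0"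
    by auto
qed

lemma fBm_moments:
  assumes "prob_space P" and B: "fBm P H B" and t: "t \<ge> 0"
  shows "B t \<in> borel_measurable P" "integrable P (B t)" "integrable P (\<lambda>\<omega>. (B t \<omega>)\<^sup>2)"
    "(\<integral>\<omega>. B t \<omega> \<partial>P) = 0" "(\<integral>\<omega>. (B t \<omega>)\<^sup>2 \<partial>P) = t powr (2 * H)"
proof -
  have "\<forall>J c. finite J \<and> J \<subseteq> {0..} \<longrightarrow> centered_gaussian P (\<lambda>\<omega>. \<Sum>r\<in>J. c r * B r \<omega>)"
    using B by (simp add: fBm_def centered_gaussian_process_def)
  from this[rule_format, of "{t}" "\<lambda>_. 1"] have g: "centered_gaussian P (B t)"
    using t by simp
  then show "B t \<in> borel_measurable P" by (simp add: centered_gaussian_def)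
  show "integrable P (B t)" "integrable P (\<lambda>\<omega>. (B t \<omega>)\<^sup>2)" "(\<integral>\<omega>. B t \<omega> \<partial>P) = 0"
    using centered_gaussian_moments[OF assms(1) g] by auto
  show "(\<integral>\<omega>. (B t \<omega>)\<^sup>2 \<partial>P) = t powr (2 * H)"
    using B[unfolded fBm_def, THEN conjunct2, rule_format, OF t t] by (simp add: power2_eq_square)
qed

text \<open>One bound for all Hurst indices, so that the variances of all summands are dominated by
  the same quadratic function of \<open>t\<close>.\<close>

lemma powr_le_one_plus_square:
  fixes t h :: real
  assumes "t \<ge> 0" "0 < h" "h < 1"
  shows "t powr (2 * h) \<le> 1 + t\<^sup>2"
proof (cases "t \<le> 1")
  case True
  then have "t powr (2 * h) \<le> 1"
    using assms by (intro powr_le1) auto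
  then show ?thesis by (simp add: add_increasing2)
next
  case False
  then have "t powr (2 * h) \<le> t powr 2"
    using assms by (intro powr_mono) auto
  then show ?thesis using False by simp
qed

text \<open>Independence and centering remove the cross terms of the squared partial sums, which
  bounds their second moments uniformly in \<open>n\<close>. The factor 2 is the price of passing to
  the limit through an elementary inequality between squares; later only the growth in
  \<open>t\<close> matters.\<close>

lemma mmfBm_second_moment:
  assumes P: "prob_space P" and \<sigma>: "summable (\<lambda>k. (\<sigma> k)\<^sup>2)" and H: "\<And>k. 0 < H k \<and> H k < 1"
    and M: "mmfBm P \<sigma> H M" and t: "t \<ge> 0"
  shows "integrable P (\<lambda>\<omega>. (M t \<omega>)\<^sup>2)"
    and "(\<integral>\<omega>. (M t \<omega>)\<^sup>2 \<partial>P) \<le> 2 * (\<Sum>k. (\<sigma> k)\<^sup>2) * (1 + t\<^sup>2)"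
proof -
  interpret prob_space P by fact
  obtain B where B: "\<And>k. fBm P (H k) (B k)"
    and ind: "indep_vars (\<lambda>k. PiM {0..} (\<lambda>_. borel)) (\<lambda>k \<omega>. \<lambda>t\<in>{0..}. B k t \<omega>) UNIV"
    and lim: "L2_tendsto P (\<lambda>n \<omega>. \<Sum>k<n. \<sigma> k * B k t \<omega>) (M t) sequentially"
    using M t by (auto simp: mmfBm_def)
  note mom = fBm_moments[OF P B t]
  note [measurable] = mom(1)
  \<comment> \<open>Evaluation at \<open>t\<close> is measurable on path space, so independence of
    the paths passes to the values \<open>B k t\<close>.\<close>
  have "indep_vars (\<lambda>k. borel) (\<lambda>k \<omega>. (\<lambda>x. x t) (\<lambda>t\<in>{0..}. B k t \<omega>)) UNIV"
    by (rule indep_vars_compose2[OF ind]) (use t in auto)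
  then have indt: "indep_vars (\<lambda>k. borel) (\<lambda>k. B k t) UNIV"
    using t by simp
  have cross: "integrable P (\<lambda>\<omega>. B k t \<omega> * B l t \<omega>) \<and>
      (\<integral>\<omega>. B k t \<omega> * B l t \<omega> \<partial>P) = (if k = l then t powr (2 * H k) else 0)" for k l
  proof (cases "k = l")
    case True
    then show ?thesis
      using mom(3,5) by (simp add: power2_eq_square)
  next
    case False
    have "indep_vars (\<lambda>k. borel) (\<lambda>k. B k t) {k, l}"
      using indt by (rule indep_vars_subset) auto
    with False show ?thesis
      using indep_vars_lebesgue_integral[of "{k, l}" "\<lambda>k. B k t"]
        indep_vars_integrable[of "{k, l}" "\<lambda>k. B k t"] mom(2,4) by simp
  qed
  define S where "S n \<omega> = (\<Sum>k<n. \<sigma> k * B k t \<omega>)" for n \<omega>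
  have S2: "(S n \<omega>)\<^sup>2 = (\<Sum>k<n. \<Sum>l<n. \<sigma> k * \<sigma> l * (B k t \<omega> * B l t \<omega>))" for n \<omega>
    by (simp add: S_def power2_eq_square sum_product mult_ac)
  have S_int: "integrable P (\<lambda>\<omega>. (S n \<omega>)\<^sup>2)" for n
    unfolding S2 using cross by (intro Bochner_Integration.integrable_sum integrable_mult_right) auto
  have S_le: "(\<integral>\<omega>. (S n \<omega>)\<^sup>2 \<partial>P) \<le> (\<Sum>k. (\<sigma> k)\<^sup>2) * (1 + t\<^sup>2)" for n
  proof -
    have "(\<integral>\<omega>. (S n \<omega>)\<^sup>2 \<partial>P) = (\<Sum>k<n. \<Sum>l<n. \<sigma> k * \<sigma> l * (if k = l then t powr (2 * H k) else 0))"
      unfolding S2 using cross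
      by (subst Bochner_Integration.integral_sum Bochner_Integration.integral_sum; simp)+
    also have "\<dots> = (\<Sum>k<n. (\<sigma> k)\<^sup>2 * t powr (2 * H k))"
      by (intro sum.cong refl) (simp add: power2_eq_square if_distrib sum.delta cong: if_cong)
    also have "\<dots> \<le> (\<Sum>k<n. (\<sigma> k)\<^sup>2 * (1 + t\<^sup>2))"
      using H t by (intro sum_mono mult_left_mono powr_le_one_plus_square) auto
    also have "\<dots> \<le> (\<Sum>k. (\<sigma> k)\<^sup>2) * (1 + t\<^sup>2)"
      unfolding sum_distrib_right[symmetric]
      by (intro mult_right_mono sum_le_suminf \<sigma>) auto
    finally show ?thesis .
  qed
  have Mt: "M t \<in> borel_measurable P" "integrable P (\<lambda>\<omega>. (M t \<omega>)\<^sup>2)"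
    using lim by (auto simp: L2_tendsto_def sq_integrable_def)
  note [measurable] = Mt(1)
  have [measurable]: "S n \<in> borel_measurable P" for n
    unfolding S_def by measurable
  show "integrable P (\<lambda>\<omega>. (M t \<omega>)\<^sup>2)" by fact
  have D_int: "integrable P (\<lambda>\<omega>. (S n \<omega> - M t \<omega>)\<^sup>2)" for n
  proof (rule Bochner_Integration.integrable_bound)
    show "integrable P (\<lambda>\<omega>. 2 * ((S n \<omega>)\<^sup>2 + (M t \<omega>)\<^sup>2))"
      using S_int Mt by auto
    show "AE \<omega> in P. norm ((S n \<omega> - M t \<omega>)\<^sup>2) \<le> norm (2 * ((S n \<omega>)\<^sup>2 + (M t \<omega>)\<^sup>2))"
      by (auto intro!: AE_I2 simp: power2_diff) (smt (verit) sum_squares_bound zero_le_power2 power2_sum power2_eq_square)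
  qed measurable
  have le: "(\<integral>\<omega>. (M t \<omega>)\<^sup>2 \<partial>P) \<le> 2 * ((\<Sum>k. (\<sigma> k)\<^sup>2) * (1 + t\<^sup>2)) + 2 * (\<integral>\<omega>. (S n \<omega> - M t \<omega>)\<^sup>2 \<partial>P)" for n
  proof -
    have "(\<integral>\<omega>. (M t \<omega>)\<^sup>2 \<partial>P) \<le> (\<integral>\<omega>. 2 * (S n \<omega>)\<^sup>2 + 2 * (S n \<omega> - M t \<omega>)\<^sup>2 \<partial>P)"
    proof (intro integral_mono Mt Bochner_Integration.integrable_add integrable_mult_right S_int D_int)
      fix \<omega>
      \<comment> \<open>The difference of the two sides of the goal is exactly this square.\<close>
      have "0 \<le> (2 * S n \<omega> - M t \<omega>)\<^sup>2" by simp
      then show "(M t \<omega>)\<^sup>2 \<le> 2 * (S n \<omega>)\<^sup>2 + 2 * (S n \<omega> - M t \<omega>)\<^sup>2"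
        by (simp add: power2_eq_square algebra_simps)
    qed
    also have "\<dots> = 2 * (\<integral>\<omega>. (S n \<omega>)\<^sup>2 \<partial>P) + 2 * (\<integral>\<omega>. (S n \<omega> - M t \<omega>)\<^sup>2 \<partial>P)"
      using S_int D_int by simp
    finally show ?thesis using S_le[of n] by linarith
  qed
  have "(\<lambda>n. \<integral>\<omega>. (S n \<omega> - M t \<omega>)\<^sup>2 \<partial>P) \<longlonglongrightarrow> 0"
    using lim by (simp add: L2_tendsto_def S_def)
  then have "(\<lambda>n. 2 * ((\<Sum>k. (\<sigma> k)\<^sup>2) * (1 + t\<^sup>2)) + 2 * (\<integral>\<omega>. (S n \<omega> - M t \<omega>)\<^sup>2 \<partial>P))
      \<longlonglongrightarrow> 2 * ((\<Sum>k. (\<sigma> k)\<^sup>2) * (1 + t\<^sup>2)) + 2 * 0"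
    by (intro tendsto_intros)
  then show "(\<integral>\<omega>. (M t \<omega>)\<^sup>2 \<partial>P) \<le> 2 * (\<Sum>k. (\<sigma> k)\<^sup>2) * (1 + t\<^sup>2)"
    using le by (intro LIMSEQ_le_const) (auto simp: mult.assoc)
qed

section \<open>Marginal laws, and the integrals by parts as random variables\<close>

lemma measurable_process_section:
  assumes "measurable_process P X"
  shows "X t \<in> borel_measurable P"
  using measurable_compose[OF measurable_Pair2'[of t borel P] assms[unfolded measurable_process_def]]
  by simp

text \<open>Projection to one coordinate is measurable for the product sigma-algebra. Nonnegative
  integrals are used so that second moments can be compared before they are known to be
  finite.\<close>

lemma nn_integral_marginal_cong:
  assumes X: "\<And>t. t \<in> I \<Longrightarrow> X t \<in> borel_measurable P"
    and Y: "\<And>t. t \<in> I \<Longrightarrow> Y t \<in> borel_measurable P"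
    and law: "process_law P I X = process_law P I Y" and t: "t \<in> I"
    and f: "f \<in> borel_measurable borel"
  shows "(\<integral>\<^sup>+\<omega>. f (X t \<omega>) \<partial>P) = (\<integral>\<^sup>+\<omega>. f (Y t \<omega>) \<partial>P)"
proof -
  have *: "(\<integral>\<^sup>+x. f (x t) \<partial>process_law P I Z) = (\<integral>\<^sup>+\<omega>. f (Z t \<omega>) \<partial>P)"
    if Z: "\<And>t. t \<in> I \<Longrightarrow> Z t \<in> borel_measurable P" for Z
  proof -
    have "(\<lambda>\<omega>. \<lambda>t\<in>I. Z t \<omega>) \<in> measurable P (PiM I (\<lambda>_. borel))"
      using Z by (intro measurable_restrict)
    then show ?thesis
      unfolding process_law_def
      using t f by (subst nn_integral_distr) (auto intro: measurable_compose[OF measurable_component_singleton])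
  qed
  show ?thesis
    using *[of X] *[of Y] X Y law by simp
qed

lemma ibp_integral_exp:
  assumes "a \<le> b"
  shows "ibp_integral (\<lambda>s. exp (c * s)) M a b \<omega> =
    exp (c * b) * M b \<omega> - exp (c * a) * M a \<omega> - c * (LINT r:{a..b}|lborel. exp (c * r) * M r \<omega>)"
proof -
  have "deriv (\<lambda>s. exp (c * s)) = (\<lambda>s. c * exp (c * s))"
    by (intro ext DERIV_imp_deriv) (auto intro!: derivative_eq_intros)
  then show ?thesis
    using assms by (simp add: ibp_integral_def interval_integral_Icc mult.assoc)
qed

text \<open>The factor \<open>exp (- c * t)\<close> is constant in the integration variable and
  passes through the derivative and the integral. Thus the kernel of the representation reduces to
  the one produced by the integrating factor.\<close>

lemma ibp_integral_exp_shift: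
  "ibp_integral (\<lambda>s. exp (- c * (t - s))) M a b \<omega> = exp (- c * t) * ibp_integral (\<lambda>s. exp (c * s)) M a b \<omega>"
proof -
  have "deriv (\<lambda>s. exp (- c * (t - s))) = (\<lambda>s. exp (- c * t) * (c * exp (c * s)))"
    by (intro ext DERIV_imp_deriv)
      (auto intro!: derivative_eq_intros simp: right_diff_distrib exp_diff exp_minus field_simps)
  moreover have "deriv (\<lambda>s. exp (c * s)) = (\<lambda>s. c * exp (c * s))"
    by (intro ext DERIV_imp_deriv) (auto intro!: derivative_eq_intros)
  moreover have "exp (- c * (t - s)) = exp (- c * t) * exp (c * s)" for s
    by (simp add: exp_add[symmetric] algebra_simps)
  ultimately show ?thesis
    by (simp add: ibp_integral_def mult.assoc right_diff_distrib del: mult_minus_left)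
qed

text \<open>The endpoint \<open>f x\<close> and the sample point \<open>g x\<close> allow two uses:
  a constant endpoint makes the integral a random variable, while \<open>snd\<close> and
  \<open>fst\<close> on a product space make it jointly measurable in time and sample point.\<close>

lemma measurable_ibp_integral_exp:
  assumes M: "measurable_process P M"
    and [measurable]: "f \<in> borel_measurable N" "g \<in> measurable N P"
    and le: "\<And>x. x \<in> space N \<Longrightarrow> a \<le> f x"
  shows "(\<lambda>x. ibp_integral (\<lambda>s. exp (c * s)) M a (f x) (g x)) \<in> borel_measurable N"
proof -
  have [measurable]: "(\<lambda>(\<omega>, t). M t \<omega>) \<in> borel_measurable (P \<Otimes>\<^sub>M borel)"
    using M by (simp add: measurable_process_def)
  have [measurable]: "(\<lambda>x. M (h x) (g x)) \<in> borel_measurable N" if [measurable]: "h \<in> borel_measurable N" for h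
    by measurable
  \<comment> \<open>The domain of integration moves with \<open>x\<close>; as a condition inside the
    integrand it becomes jointly measurable in \<open>x\<close> and \<open>r\<close>.\<close>
  have eq: "(LINT r:{a..f x}|lborel. exp (c * r) * M r (g x)) =
      (\<integral>r. (if a \<le> r \<and> r \<le> f x then exp (c * r) * M r (g x) else 0) \<partial>lborel)" for x
    unfolding set_lebesgue_integral_def
    by (intro Bochner_Integration.integral_cong) (auto simp: indicator_def)
  have "(\<lambda>x. exp (c * f x) * M (f x) (g x) - exp (c * a) * M a (g x) -
      c * (LINT r:{a..f x}|lborel. exp (c * r) * M r (g x))) \<in> borel_measurable N"
    unfolding eq by measurable
  then show ?thesis
    by (rule measurable_cong[THEN iffD1, rotated]) (simp add: ibp_integral_exp le)
qed

text \<open>The exceptional null set of the Langevin equation depends on the time \<open>r\<close>.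
  Fubini exchanges the quantifiers: almost every path satisfies the equation for almost every
  \<open>r\<close>, which is what the pathwise argument requires. The endpoint \<open>t\<close> is
  again treated on its own.\<close>

lemma langevin_solution_integrating_factor:
  assumes P: "prob_space P" and M: "measurable_process P M" and U: "langevin_solution P c M U"
    and c: "c \<noteq> 0" and st: "s \<le> t"
  shows "AE \<omega> in P. exp (c * t) * U t \<omega> = exp (c * s) * U s \<omega> + ibp_integral (\<lambda>r. exp (c * r)) M s t \<omega>"
proof -
  interpret prob_space P by fact
  interpret pair_sigma_finite P lborel ..
  have [measurable]: "(\<lambda>(\<omega>, t). M t \<omega>) \<in> borel_measurable (P \<Otimes>\<^sub>M borel)"
    using M by (simp add: measurable_process_def)
  have [measurable]: "(\<lambda>(\<omega>, t). U t \<omega>) \<in> borel_measurable (P \<Otimes>\<^sub>M borel)"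
    using U by (simp add: langevin_solution_def measurable_process_def)
  define Q where "Q \<omega> r \<longleftrightarrow> r \<in> {s..t} \<longrightarrow>
    U r \<omega> - U s \<omega> = - c * (LINT q:{s..r}|lborel. U q \<omega>) + (M r \<omega> - M s \<omega>)" for \<omega> r
  have Q: "AE \<omega> in P. Q \<omega> r" for r
  proof (cases "s \<le> r")
    case True
    then have "AE \<omega> in P. U r \<omega> - U s \<omega> =
        - c * (LBINT q=s..r. U q \<omega>) + ibp_integral (\<lambda>_. 1) M s r \<omega>"
      using U by (simp add: langevin_solution_def)
    with True show ?thesis
      by (simp add: Q_def ibp_integral_def interval_integral_Icc)
  qed (simp add: Q_def)
  have eq: "(LINT q:{s..r}|lborel. U q \<omega>) =
      (\<integral>q. (if s \<le> q \<and> q \<le> r then U q \<omega> else 0) \<partial>lborel)" for r \<omega>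
    unfolding set_lebesgue_integral_def
    by (intro Bochner_Integration.integral_cong) (auto simp: indicator_def)
  \<comment> \<open>Joint measurability of the set of good pairs is the condition for exchanging the
    two almost-everywhere quantifiers.\<close>
  have "{x \<in> space (P \<Otimes>\<^sub>M lborel). Q (fst x) (snd x)} \<in> sets (P \<Otimes>\<^sub>M lborel)"
    unfolding Q_def eq by measurable
  then have "AE \<omega> in P. AE r in lborel. Q \<omega> r"
    using Q by (simp add: AE_commute)
  moreover have "AE \<omega> in P. set_integrable lborel {s..t} (\<lambda>q. U q \<omega>)"
    using U by (simp add: langevin_solution_def)
  ultimately show ?thesis
    using Q[of t] AE_space
  proof eventually_elim
    case (elim \<omega>)
    have [measurable]: "(\<lambda>r. M r \<omega>) \<in> borel_measurable borel"
      using \<open>\<omega> \<in> space P\<close> by measurable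
    have "exp (c * t) * U t \<omega> - exp (c * s) * U s \<omega> = exp (c * t) * M t \<omega> - exp (c * s) * M s \<omega> -
        c * (LINT r:{s..t}|lborel. exp (c * r) * M r \<omega>)"
      using elim st by (intro integrating_factor c) (auto simp: Q_def)
    then show ?case
      using st by (simp add: ibp_integral_exp)
  qed
qed

section \<open>Second moments of the integrals over the past, uniformly in the lower
  endpoint\<close>

lemma exp_weighted_Cauchy_Schwarz:
  fixes m :: "real \<Rightarrow> real" and a c :: real
  assumes c: "c > 0" and a: "a \<le> 0" and [measurable]: "m \<in> borel_measurable borel"
  shows "ennreal ((c * (LINT r:{a..0}|lborel. exp (c * r) * m r))\<^sup>2) \<le>
    (\<integral>\<^sup>+r. ennreal (c * exp (c * r) * (m r)\<^sup>2) * indicator {a..0} r \<partial>lborel)"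
proof (cases "(\<integral>\<^sup>+r. ennreal (c * exp (c * r) * (m r)\<^sup>2) * indicator {a..0} r \<partial>lborel) = \<infinity>")
  case False
  define w where "w r = indicator {a..0} r * exp (c * r)" for r
  have [measurable]: "w \<in> borel_measurable borel"
    unfolding w_def by measurable
  have w0: "0 \<le> w r" for r by (simp add: w_def)
  have w: "integrable lborel w" and "(\<integral>r. w r \<partial>lborel) = (1 - exp (c * a)) / c"
    using set_lebesgue_integral_exp[OF a, of c] c
    by (auto simp: w_def[abs_def] set_integrable_def set_lebesgue_integral_def)
  \<comment> \<open>So \<open>c * w r\<close> is a sub-probability density, and the inequality
    carries no factor depending on \<open>a\<close>.\<close>
  then have W: "c * (\<integral>r. w r \<partial>lborel) \<le> 1" using c by simp
  have nn: "(\<integral>\<^sup>+r. ennreal (c * (w r * (m r)\<^sup>2)) \<partial>lborel) =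
      (\<integral>\<^sup>+r. ennreal (c * exp (c * r) * (m r)\<^sup>2) * indicator {a..0} r \<partial>lborel)"
    by (intro nn_integral_cong) (auto simp: w_def indicator_def mult.assoc)
  have "integrable lborel (\<lambda>r. c * (w r * (m r)\<^sup>2))"
    using False nn c w0 by (intro integrableI_nonneg) (auto simp: less_top)
  then have Q: "integrable lborel (\<lambda>r. w r * (m r)\<^sup>2)"
    using c by simp
  have J: "integrable lborel (\<lambda>r. w r * m r)"
  proof (rule Bochner_Integration.integrable_bound)
    show "integrable lborel (\<lambda>r. w r + w r * (m r)\<^sup>2)" using w Q by simp
    have "\<bar>m r\<bar> \<le> 1 + (m r)\<^sup>2" for r
      using zero_le_power2[of "\<bar>m r\<bar> - 1"] by (simp add: power2_diff)
    then have "w r * \<bar>m r\<bar> \<le> w r * (1 + (m r)\<^sup>2)" for r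
      using w0 by (intro mult_left_mono)
    then show "AE r in lborel. norm (w r * m r) \<le> norm (w r + w r * (m r)\<^sup>2)"
      using w0 by (simp add: abs_mult distrib_left)
  qed measurable
  define j where "j = (\<integral>r. w r * m r \<partial>lborel)"
  \<comment> \<open>Expanding this square around the weighted mean \<open>c * j\<close> proves the
    Cauchy-Schwarz inequality: the mass bound \<open>W\<close> leaves \<open>c * j\<^sup>2\<close>
    below the weighted integral of \<open>(m r)\<^sup>2\<close>.\<close>
  have "0 \<le> (\<integral>r. w r * (m r - c * j)\<^sup>2 \<partial>lborel)"
    using w0 by (intro Bochner_Integration.integral_nonneg) auto
  also have "\<dots> = (\<integral>r. w r * (m r)\<^sup>2 - 2 * c * j * (w r * m r) + (c * j)\<^sup>2 * w r \<partial>lborel)"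
    by (intro Bochner_Integration.integral_cong) (auto simp: power2_eq_square algebra_simps)
  also have "\<dots> = (\<integral>r. w r * (m r)\<^sup>2 \<partial>lborel) - 2 * c * j * j + (c * j)\<^sup>2 * (\<integral>r. w r \<partial>lborel)"
    using w Q J by (simp add: j_def)
  finally have "0 \<le> (\<integral>r. w r * (m r)\<^sup>2 \<partial>lborel) - 2 * c * j * j + (c * j\<^sup>2) * (c * (\<integral>r. w r \<partial>lborel))"
    by (simp add: power2_eq_square mult_ac)
  also have "(c * j\<^sup>2) * (c * (\<integral>r. w r \<partial>lborel)) \<le> c * j\<^sup>2 * 1"
    using c W by (intro mult_left_mono) auto
  finally have "c * j\<^sup>2 \<le> (\<integral>r. w r * (m r)\<^sup>2 \<partial>lborel)"
    by (simp add: power2_eq_square)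
  then have "c * (c * j\<^sup>2) \<le> (\<integral>r. c * (w r * (m r)\<^sup>2) \<partial>lborel)"
    using c by simp
  then have "ennreal (c * (c * j\<^sup>2)) \<le> (\<integral>\<^sup>+r. ennreal (c * (w r * (m r)\<^sup>2)) \<partial>lborel)"
    using Q c w0 by (subst nn_integral_eq_integral) (auto intro!: ennreal_leI)
  moreover have "(c * (LINT r:{a..0}|lborel. exp (c * r) * m r))\<^sup>2 = c * (c * j\<^sup>2)"
    by (simp add: j_def w_def set_lebesgue_integral_def mult.assoc power2_eq_square)
  ultimately show ?thesis
    unfolding nn by (simp only:)
qed simp

text \<open>Equality of the laws, read at the single time \<open>t\<close>, carries the variance
  bound over to the time \<open>- t\<close>.\<close>

lemma past_second_moment:
  assumes P: "prob_space P" and \<sigma>: "summable (\<lambda>k. (\<sigma> k)\<^sup>2)" and H: "\<And>k. 0 < H k \<and> H k < 1"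
    and M: "mmfBm P \<sigma> H M" and meas: "measurable_process P M" and copy: "past_is_copy P M"
    and t: "t \<ge> 0"
  shows "(\<integral>\<^sup>+\<omega>. ennreal ((M (- t) \<omega>)\<^sup>2) \<partial>P) \<le> ennreal (2 * (\<Sum>k. (\<sigma> k)\<^sup>2) * (1 + t\<^sup>2))"
proof -
  have "(\<integral>\<^sup>+\<omega>. ennreal ((M (- t) \<omega>)\<^sup>2) \<partial>P) = (\<integral>\<^sup>+\<omega>. ennreal ((M t \<omega>)\<^sup>2) \<partial>P)"
    using copy[unfolded past_is_copy_def] measurable_process_section[OF meas] t
    by (intro nn_integral_marginal_cong[where X = "\<lambda>s. M (- s)" and f = "\<lambda>x. ennreal (x\<^sup>2)"]) auto
  also have "\<dots> = ennreal (\<integral>\<omega>. (M t \<omega>)\<^sup>2 \<partial>P)"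
    using mmfBm_second_moment(1)[OF P \<sigma> H M t] by (intro nn_integral_eq_integral) auto
  also have "\<dots> \<le> ennreal (2 * (\<Sum>k. (\<sigma> k)\<^sup>2) * (1 + t\<^sup>2))"
    using mmfBm_second_moment(2)[OF P \<sigma> H M t] by (rule ennreal_leI)
  finally show ?thesis .
qed

text \<open>The rate \<open>c / 2\<close> is half that of the weight \<open>exp (c * r)\<close>, so
  at \<open>r = - t\<close> the product still decays exponentially. With
  \<open>x = c * t / 2\<close> one has \<open>t\<^sup>2 = (4 / c\<^sup>2) * x\<^sup>2\<close>, and
  \<open>x\<^sup>2 \<le> 2 * exp x\<close> yields the constant \<open>8 / c\<^sup>2\<close>.\<close>

lemma one_plus_square_le_exp:
  fixes c t :: real
  assumes "c > 0" "t \<ge> 0"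
  shows "1 + t\<^sup>2 \<le> (1 + 8 / c\<^sup>2) * exp (c * t / 2)"
proof -
  define x where "x = c * t / 2"
  have x: "0 \<le> x" using assms by (simp add: x_def)
  have e: "1 + x + x\<^sup>2 / 2 \<le> exp x"
    using x by (rule exp_lower_Taylor_quadratic)
  have "x\<^sup>2 \<le> 2 * exp x" "1 \<le> exp x"
    using e x zero_le_power2[of x] by linarith+
  then have "1 + (4 / c\<^sup>2) * x\<^sup>2 \<le> exp x + (4 / c\<^sup>2) * (2 * exp x)"
    by (intro add_mono mult_left_mono) auto
  then show ?thesis
    using assms by (simp add: x_def algebra_simps power_divide power_mult_distrib)
qed

text \<open>The point is that the bound does not depend on \<open>a\<close>. The square of the three
  terms is split at the cost of a factor 3; the value at 0, the lower boundary term and the weighted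
  integral then contribute \<open>3 * K\<close>, \<open>3 * K\<close> and
  \<open>3 * (2 * K)\<close>.\<close>

lemma ibp_integral_exp_second_moment:
  assumes P: "prob_space P" and meas: "measurable_process P M" and c: "c > 0" and a: "a \<le> 0"
    and K: "K \<ge> 0"
    and bound: "\<And>t. t \<ge> 0 \<Longrightarrow> (\<integral>\<^sup>+\<omega>. ennreal ((M (- t) \<omega>)\<^sup>2) \<partial>P) \<le> ennreal (K * exp (c * t / 2))"
  shows "(\<integral>\<^sup>+\<omega>. ennreal ((ibp_integral (\<lambda>s. exp (c * s)) M a 0 \<omega>)\<^sup>2) \<partial>P) \<le> ennreal (12 * K)"
proof -
  interpret prob_space P by fact
  interpret pair_sigma_finite P lborel ..
  have [measurable]: "(\<lambda>(\<omega>, t). M t \<omega>) \<in> borel_measurable (P \<Otimes>\<^sub>M borel)"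
    using meas by (simp add: measurable_process_def)
  have [measurable]: "M t \<in> borel_measurable P" for t
    by (rule measurable_process_section[OF meas])
  have bound': "(\<integral>\<^sup>+\<omega>. ennreal ((M r \<omega>)\<^sup>2) \<partial>P) \<le> ennreal (K * exp (- (c * r) / 2))" if "r \<le> 0" for r
    using bound[of "- r"] that by simp
  define J where "J \<omega> = c * (LINT r:{a..0}|lborel. exp (c * r) * M r \<omega>)" for \<omega>
  have sq: "(x - y - z)\<^sup>2 \<le> 3 * x\<^sup>2 + 3 * y\<^sup>2 + 3 * z\<^sup>2" for x y z :: real
  proof -
    \<comment> \<open>This sum of squares is exactly the difference of the two sides.\<close>
    have "0 \<le> (x + y)\<^sup>2 + (x + z)\<^sup>2 + (y - z)\<^sup>2" by simp
    then show ?thesis by (simp add: power2_eq_square algebra_simps)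
  qed
  define Q where "Q \<omega> = (\<integral>\<^sup>+r. ennreal (c * exp (c * r) * (M r \<omega>)\<^sup>2) * indicator {a..0} r \<partial>lborel)" for \<omega>
  have [measurable]: "Q \<in> borel_measurable P"
    unfolding Q_def by measurable
  have pt: "ennreal ((ibp_integral (\<lambda>s. exp (c * s)) M a 0 \<omega>)\<^sup>2) \<le>
      3 * ennreal ((M 0 \<omega>)\<^sup>2) + 3 * (ennreal (exp (2 * (c * a))) * ennreal ((M a \<omega>)\<^sup>2)) + 3 * Q \<omega>"
    if "\<omega> \<in> space P" for \<omega>
  proof -
    have [measurable]: "(\<lambda>r. M r \<omega>) \<in> borel_measurable borel"
      using that by measurable
    have "ennreal ((ibp_integral (\<lambda>s. exp (c * s)) M a 0 \<omega>)\<^sup>2) \<le>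
        ennreal (3 * (M 0 \<omega>)\<^sup>2 + 3 * (exp (c * a) * M a \<omega>)\<^sup>2 + 3 * (J \<omega>)\<^sup>2)"
      using sq[of "M 0 \<omega>" "exp (c * a) * M a \<omega>" "J \<omega>"] a
      by (intro ennreal_leI) (simp add: ibp_integral_exp J_def)
    also have "\<dots> = 3 * ennreal ((M 0 \<omega>)\<^sup>2) + 3 * (ennreal (exp (2 * (c * a))) * ennreal ((M a \<omega>)\<^sup>2)) +
        3 * ennreal ((J \<omega>)\<^sup>2)"
      by (simp add: ennreal_plus ennreal_mult power_mult_distrib exp_double)
    also have "ennreal ((J \<omega>)\<^sup>2) \<le> Q \<omega>"
      unfolding J_def Q_def using c a by (intro exp_weighted_Cauchy_Schwarz) auto
    finally show ?thesis
      by (simp add: add_left_mono mult_left_mono)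
  qed
  have Q_le: "(\<integral>\<^sup>+\<omega>. Q \<omega> \<partial>P) \<le> ennreal (2 * K)"
  proof -
    \<comment> \<open>After Tonelli, the weight \<open>exp (c * r)\<close> beats the growth
      \<open>exp (- (c * r) / 2)\<close> and leaves \<open>K * c * exp (c / 2 * r)\<close>. Its
      primitive \<open>2 * K * exp (c / 2 * r)\<close> gives the bound \<open>2 * K\<close>.\<close>
    have "(\<integral>\<^sup>+\<omega>. Q \<omega> \<partial>P) =
        (\<integral>\<^sup>+r. (\<integral>\<^sup>+\<omega>. ennreal (c * exp (c * r) * (M r \<omega>)\<^sup>2) * indicator {a..0} r \<partial>P) \<partial>lborel)"
      unfolding Q_def by (rule Fubini'[symmetric]) measurable
    also have "\<dots> = (\<integral>\<^sup>+r. ennreal (c * exp (c * r)) * (\<integral>\<^sup>+\<omega>. ennreal ((M r \<omega>)\<^sup>2) \<partial>P) * indicator {a..0} r \<partial>lborel)"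
      using c by (intro nn_integral_cong) (simp add: nn_integral_multc nn_integral_cmult ennreal_mult)
    also have "\<dots> \<le> (\<integral>\<^sup>+r. ennreal (c * exp (c * r)) * ennreal (K * exp (- (c * r) / 2)) * indicator {a..0} r \<partial>lborel)"
      using bound' by (intro nn_integral_mono) (auto simp: indicator_def intro!: mult_left_mono)
    also have "\<dots> = (\<integral>\<^sup>+r. ennreal (K * c * exp (c / 2 * r)) * indicator {a..0} r \<partial>lborel)"
    proof (intro nn_integral_cong)
      fix r :: real
      have "c * exp (c * r) * (K * exp (- (c * r) / 2)) = K * c * exp (c * r + - (c * r) / 2)"
        by (simp only: exp_add mult_ac)
      also have "c * r + - (c * r) / 2 = c / 2 * r" by simp
      finally have "c * exp (c * r) * (K * exp (- (c * r) / 2)) = K * c * exp (c / 2 * r)" .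
      moreover have "ennreal (c * exp (c * r)) * ennreal (K * exp (- (c * r) / 2)) =
          ennreal (c * exp (c * r) * (K * exp (- (c * r) / 2)))"
        using c K by (intro ennreal_mult[symmetric]) auto
      ultimately show "ennreal (c * exp (c * r)) * ennreal (K * exp (- (c * r) / 2)) * indicator {a..0} r =
          ennreal (K * c * exp (c / 2 * r)) * indicator {a..0} r"
        by (simp only:)
    qed
    also have "\<dots> = ennreal (2 * K * exp (c / 2 * 0) - 2 * K * exp (c / 2 * a))"
      using a c K by (intro nn_integral_FTC_Icc) (auto intro!: derivative_eq_intros)
    also have "\<dots> \<le> ennreal (2 * K)"
      using K by (intro ennreal_leI) simp
    finally show ?thesis .
  qed
  \<comment> \<open>The exponents add up to \<open>3 / 2 * (c * a)\<close>, which is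
    nonpositive.\<close>
  have "exp (2 * (c * a)) * (K * exp (- (c * a) / 2)) = K * exp (2 * (c * a) + - (c * a) / 2)"
    by (simp only: exp_add mult_ac)
  also have "\<dots> \<le> K * 1"
    using K a c by (intro mult_left_mono) (auto simp: mult_nonneg_nonpos mult_nonpos_nonneg)
  finally have Ka: "exp (2 * (c * a)) * (K * exp (- (c * a) / 2)) \<le> K" by simp
  have "(\<integral>\<^sup>+\<omega>. ennreal ((ibp_integral (\<lambda>s. exp (c * s)) M a 0 \<omega>)\<^sup>2) \<partial>P) \<le>
      (\<integral>\<^sup>+\<omega>. 3 * ennreal ((M 0 \<omega>)\<^sup>2) + 3 * (ennreal (exp (2 * (c * a))) * ennreal ((M a \<omega>)\<^sup>2)) + 3 * Q \<omega> \<partial>P)"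
    using pt by (intro nn_integral_mono)
  also have "\<dots> = 3 * (\<integral>\<^sup>+\<omega>. ennreal ((M 0 \<omega>)\<^sup>2) \<partial>P) +
      3 * (ennreal (exp (2 * (c * a))) * (\<integral>\<^sup>+\<omega>. ennreal ((M a \<omega>)\<^sup>2) \<partial>P)) + 3 * (\<integral>\<^sup>+\<omega>. Q \<omega> \<partial>P)"
    by (simp add: nn_integral_add nn_integral_cmult)
  also have "\<dots> \<le> 3 * ennreal K + 3 * (ennreal (exp (2 * (c * a))) * ennreal (K * exp (- (c * a) / 2))) + 3 * ennreal (2 * K)"
    using bound'[of 0] bound'[of a] a Q_le by (intro add_mono mult_left_mono) auto
  also have "\<dots> \<le> 3 * ennreal K + 3 * ennreal K + 3 * ennreal (2 * K)"
    using Ka K by (intro add_mono mult_left_mono order_refl) (auto simp: ennreal_mult[symmetric] intro!: ennreal_leI)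
  also have "\<dots> = ennreal (12 * K)"
  proof -
    have 3: "(3 :: ennreal) = ennreal 3" by simp
    show ?thesis
      unfolding 3 using K by (simp only: ennreal_mult[symmetric] ennreal_plus[symmetric] mult_nonneg_nonneg add_nonneg_nonneg) simp
  qed
  finally show ?thesis .
qed

section \<open>Truncation and the vanishing remainder\<close>

lemma SUP_min_of_nat_ennreal:
  "(SUP n. min (ennreal x) (of_nat n)) = ennreal x"
proof (rule antisym)
  obtain n where "x \<le> of_nat n" using real_arch_simple by blast
  then have "ennreal x \<le> min (ennreal x) (of_nat n)"
    by (simp add: ennreal_of_nat_eq_real_of_nat ennreal_leI)
  then show "ennreal x \<le> (SUP n. min (ennreal x) (of_nat n))"
    by (intro SUP_upper2) auto
qed (auto intro!: SUP_least)

text \<open>Truncation makes the remainder \<open>e n * Y n\<close>, whose second moment is not known to be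
  finite, disappear in the limit, since its law is that of \<open>e n * X\<close>.\<close>

lemma second_moment_le_of_vanishing_remainder:
  assumes P: "prob_space P"
    and [measurable]: "X \<in> borel_measurable P" "\<And>n. Z n \<in> borel_measurable P"
      "\<And>n. Y n \<in> borel_measurable P"
    and dec: "\<And>n. AE \<omega> in P. X \<omega> = e n * Y n \<omega> + Z n \<omega>"
    and law: "\<And>n f. f \<in> borel_measurable borel \<Longrightarrow> (\<integral>\<^sup>+\<omega>. f (Y n \<omega>) \<partial>P) = (\<integral>\<^sup>+\<omega>. f (X \<omega>) \<partial>P)"
    and e: "e \<longlonglongrightarrow> 0"
    and Z: "\<And>n. (\<integral>\<^sup>+\<omega>. ennreal ((Z n \<omega>)\<^sup>2) \<partial>P) \<le> C"
  shows "(\<integral>\<^sup>+\<omega>. ennreal ((X \<omega>)\<^sup>2) \<partial>P) \<le> 2 * C"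
proof -
  interpret prob_space P by fact
  have trunc: "(\<integral>\<^sup>+\<omega>. min (ennreal ((X \<omega>)\<^sup>2)) (of_nat K) \<partial>P) \<le> 2 * C" for K :: nat
  proof -
    \<comment> \<open>The \<open>Y n\<close> need not converge pointwise. With \<open>X\<close> in
      their place the expectation is unchanged, the integrand tends to 0 pointwise because
      \<open>e\<close> does, and the truncation level dominates it.\<close>
    define g where "g n \<omega> = min (ennreal ((e n * X \<omega>)\<^sup>2)) (of_nat K)" for n \<omega>
    have [measurable]: "g n \<in> borel_measurable P" for n
      unfolding g_def by measurable
    have "(\<lambda>n. \<integral>\<^sup>+\<omega>. g n \<omega> \<partial>P) \<longlonglongrightarrow> (\<integral>\<^sup>+\<omega>. 0 \<partial>P)"
    proof (rule nn_integral_dominated_convergence[where w = "\<lambda>_. of_nat K"])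
      show "AE \<omega> in P. (\<lambda>n. g n \<omega>) \<longlonglongrightarrow> 0"
      proof (rule AE_I2)
        fix \<omega>
        have "(\<lambda>n. ennreal ((e n * X \<omega>)\<^sup>2)) \<longlonglongrightarrow> ennreal ((0 * X \<omega>)\<^sup>2)"
          by (intro tendsto_intros e)
        then have lim: "(\<lambda>n. ennreal ((e n * X \<omega>)\<^sup>2)) \<longlonglongrightarrow> 0" by simp
        show "(\<lambda>n. g n \<omega>) \<longlonglongrightarrow> 0"
          by (rule tendsto_sandwich[OF _ _ tendsto_const lim]) (auto simp: g_def)
      qed
    qed (auto simp: g_def emeasure_space_1 of_nat_less_top)
    then have "(\<lambda>n. 2 * (\<integral>\<^sup>+\<omega>. g n \<omega> \<partial>P) + 2 * C) \<longlonglongrightarrow> 2 * 0 + 2 * C"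
      by (intro tendsto_add tendsto_const ennreal_tendsto_cmult) auto
    moreover have "(\<integral>\<^sup>+\<omega>. min (ennreal ((X \<omega>)\<^sup>2)) (of_nat K) \<partial>P) \<le> 2 * (\<integral>\<^sup>+\<omega>. g n \<omega> \<partial>P) + 2 * C" for n
    proof -
      \<comment> \<open>Only \<open>x\<close>, in the role of the remainder, stays truncated;
        \<open>z\<close> keeps its full square, whose expectation is controlled by
        \<open>C\<close>.\<close>
      have min2: "min (ennreal ((x + z)\<^sup>2)) (of_nat K) \<le> 2 * min (ennreal (x\<^sup>2)) (of_nat K) + 2 * ennreal (z\<^sup>2)" for x z :: real
      proof -
        have "min ((x + z)\<^sup>2) (real K) \<le> 2 * min (x\<^sup>2) (real K) + 2 * z\<^sup>2"
        proof -
          have "0 \<le> (x - z)\<^sup>2" by simp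
          then have "(x + z)\<^sup>2 \<le> 2 * x\<^sup>2 + 2 * z\<^sup>2"
            by (simp add: power2_eq_square algebra_simps)
          then show ?thesis using zero_le_power2[of z] of_nat_0_le_iff[of K] by (smt (verit) min_def)
        qed
        then have "ennreal (min ((x + z)\<^sup>2) (real K)) \<le> ennreal (2 * min (x\<^sup>2) (real K) + 2 * z\<^sup>2)"
          by (rule ennreal_leI)
        then show ?thesis
          by (simp add: ennreal_plus ennreal_mult ennreal_of_nat_eq_real_of_nat min_ennreal[symmetric])
      qed
      have "(\<integral>\<^sup>+\<omega>. min (ennreal ((X \<omega>)\<^sup>2)) (of_nat K) \<partial>P) \<le>
          (\<integral>\<^sup>+\<omega>. 2 * min (ennreal ((e n * Y n \<omega>)\<^sup>2)) (of_nat K) + 2 * ennreal ((Z n \<omega>)\<^sup>2) \<partial>P)"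
      proof (rule nn_integral_mono_AE)
        show "AE \<omega> in P. min (ennreal ((X \<omega>)\<^sup>2)) (of_nat K) \<le>
            2 * min (ennreal ((e n * Y n \<omega>)\<^sup>2)) (of_nat K) + 2 * ennreal ((Z n \<omega>)\<^sup>2)"
          using dec[of n] by eventually_elim (simp only: min2)
      qed
      also have "\<dots> = 2 * (\<integral>\<^sup>+\<omega>. min (ennreal ((e n * Y n \<omega>)\<^sup>2)) (of_nat K) \<partial>P) +
          2 * (\<integral>\<^sup>+\<omega>. ennreal ((Z n \<omega>)\<^sup>2) \<partial>P)"
        by (simp add: nn_integral_add nn_integral_cmult)
      also have "(\<integral>\<^sup>+\<omega>. min (ennreal ((e n * Y n \<omega>)\<^sup>2)) (of_nat K) \<partial>P) = (\<integral>\<^sup>+\<omega>. g n \<omega> \<partial>P)"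
        unfolding g_def by (rule law) measurable
      finally show ?thesis
        using Z[of n] by (meson add_left_mono mult_left_mono order_trans zero_le)
    qed
    ultimately show ?thesis
      by (intro LIMSEQ_le_const) auto
  qed
  \<comment> \<open>The bound is the same for every truncation level, so monotone convergence
    removes the truncation.\<close>
  have "(\<integral>\<^sup>+\<omega>. ennreal ((X \<omega>)\<^sup>2) \<partial>P) = (\<integral>\<^sup>+\<omega>. (SUP K. min (ennreal ((X \<omega>)\<^sup>2)) (of_nat K)) \<partial>P)"
    by (simp add: SUP_min_of_nat_ennreal)
  also have "\<dots> = (SUP K. \<integral>\<^sup>+\<omega>. min (ennreal ((X \<omega>)\<^sup>2)) (of_nat K) \<partial>P)"
    by (intro nn_integral_monotone_convergence_SUP)
      (auto simp: incseq_def le_fun_def min.coboundedI2)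
  also have "\<dots> \<le> 2 * C"
    by (intro SUP_least trunc)
  finally show ?thesis .
qed

theorem proposition2p3:
  fixes P :: "'a measure" and \<sigma> H :: "nat \<Rightarrow> real" and lam :: real
    and M U :: "real \<Rightarrow> 'a \<Rightarrow> real"
  assumes "prob_space P"
    and "\<And>k. \<sigma> k > 0" and "summable (\<lambda>k. (\<sigma> k)\<^sup>2)"
    and "\<And>k. 0 < H k \<and> H k < 1" and "\<And>k l. k \<noteq> l \<Longrightarrow> H k \<noteq> H l"
    and "(INF k. H k) > 0" and "(SUP k. H k) < 1"
    and "lam > 0"
    and "measurable_process P M"
    and "mmfBm P \<sigma> H M"
    and "past_is_copy P M"
    and "mmfOU P lam M U"
  shows "\<exists>\<xi>. L2_tendsto P (\<lambda>a. ibp_integral (\<lambda>s. exp (lam * s)) M a 0) \<xi> at_bot \<and>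
    (\<forall>T>0. L2_eq (time_product P T) (\<lambda>(\<omega>, t). U t \<omega>)
      (\<lambda>(\<omega>, t). exp (- lam * t) * \<xi> \<omega> + ibp_integral (\<lambda>s. exp (- lam * (t - s))) M 0 t \<omega>))"
proof -
  interpret prob_space P by fact
  note P = \<open>prob_space P\<close> and lam = \<open>lam > 0\<close> and M = \<open>measurable_process P M\<close>
  have lang: "langevin_solution P lam M U" and stat: "stationary_process P U"
    using \<open>mmfOU P lam M U\<close> by (auto simp: mmfOU_def)
  then have U: "measurable_process P U" by (simp add: langevin_solution_def)
  have [measurable]: "U t \<in> borel_measurable P" for t
    by (rule measurable_process_section[OF U])
  have [measurable]: "ibp_integral (\<lambda>s. exp (lam * s)) M a b \<in> borel_measurable P" if "a \<le> b" for a b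
    using measurable_ibp_integral_exp[OF M, of "\<lambda>_. b" P "\<lambda>\<omega>. \<omega>" a lam] that by simp
  have law: "(\<integral>\<^sup>+\<omega>. f (U t \<omega>) \<partial>P) = (\<integral>\<^sup>+\<omega>. f (U 0 \<omega>) \<partial>P)" if "f \<in> borel_measurable borel" for t f
    using stat[unfolded stationary_process_def, rule_format, of t] that
      nn_integral_marginal_cong[of UNIV "\<lambda>s. U (s + t)" P U 0 f] by simp
  have flow: "AE \<omega> in P. exp (lam * t) * U t \<omega> = exp (lam * s) * U s \<omega> + ibp_integral (\<lambda>r. exp (lam * r)) M s t \<omega>"
    if "s \<le> t" for s t
    using langevin_solution_integrating_factor[OF P M lang _ that] lam by simp

  \<comment> \<open>Square integrability of the stationary solution\<close>
  define K where "K = 2 * (\<Sum>k. (\<sigma> k)\<^sup>2) * (1 + 8 / lam\<^sup>2)"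
  have S: "0 \<le> (\<Sum>k. (\<sigma> k)\<^sup>2)"
    using assms(3) by (intro suminf_nonneg) auto
  then have K: "0 \<le> K" by (simp add: K_def)
  have M2: "(\<integral>\<^sup>+\<omega>. ennreal ((M (- t) \<omega>)\<^sup>2) \<partial>P) \<le> ennreal (K * exp (lam * t / 2))" if "t \<ge> 0" for t
  proof -
    have "2 * (\<Sum>k. (\<sigma> k)\<^sup>2) * (1 + t\<^sup>2) \<le> 2 * (\<Sum>k. (\<sigma> k)\<^sup>2) * ((1 + 8 / lam\<^sup>2) * exp (lam * t / 2))"
      using one_plus_square_le_exp[OF lam that] S by (intro mult_left_mono) auto
    then show ?thesis
      using past_second_moment[OF P assms(3,4) \<open>mmfBm P \<sigma> H M\<close> M \<open>past_is_copy P M\<close> that]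
      by (elim order_trans) (simp add: K_def mult.assoc ennreal_leI)
  qed

  \<comment> \<open>The integrated equation from \<open>- n\<close> to 0 writes \<open>U 0\<close>
    as an integral with second moment at most \<open>12 * K\<close> plus
    \<open>exp (- lam * n)\<close> times a variable with the law of \<open>U 0\<close>.\<close>
  have "(\<integral>\<^sup>+\<omega>. ennreal ((U 0 \<omega>)\<^sup>2) \<partial>P) \<le> 2 * ennreal (12 * K)"
  proof (rule second_moment_le_of_vanishing_remainder[OF P])
    fix n :: nat
    show "AE \<omega> in P. U 0 \<omega> = exp (lam * (- real n)) * U (- real n) \<omega> +
        ibp_integral (\<lambda>r. exp (lam * r)) M (- real n) 0 \<omega>"
      using flow[of "- real n" 0] by simp
    show "(\<integral>\<^sup>+\<omega>. ennreal ((ibp_integral (\<lambda>r. exp (lam * r)) M (- real n) 0 \<omega>)\<^sup>2) \<partial>P) \<le> ennreal (12 * K)"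
      by (intro ibp_integral_exp_second_moment P M lam K M2) auto
    show "(\<integral>\<^sup>+\<omega>. f (U (- real n) \<omega>) \<partial>P) = (\<integral>\<^sup>+\<omega>. f (U 0 \<omega>) \<partial>P)" if "f \<in> borel_measurable borel" for f
      using that by (rule law)
  next
    have "filterlim (\<lambda>n. lam * (- real n)) at_bot sequentially"
      using filterlim_tendsto_pos_mult_at_top[OF tendsto_const lam filterlim_real_sequentially]
      by (simp add: filterlim_uminus_at_top)
    then show "(\<lambda>n. exp (lam * (- real n))) \<longlonglongrightarrow> 0"
      by (rule filterlim_compose[OF exp_at_bot])
  qed auto
  also have "2 * ennreal (12 * K) < \<infinity>"
    by (simp add: ennreal_mult_less_top)
  finally have U0_fin: "(\<integral>\<^sup>+\<omega>. ennreal ((U 0 \<omega>)\<^sup>2) \<partial>P) < \<infinity>" .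
  have U2_fin: "(\<integral>\<^sup>+\<omega>. ennreal ((U t \<omega>)\<^sup>2) \<partial>P) = (\<integral>\<^sup>+\<omega>. ennreal ((U 0 \<omega>)\<^sup>2) \<partial>P)" for t
    by (rule law) measurable
  have U2: "integrable P (\<lambda>\<omega>. (U t \<omega>)\<^sup>2)" for t
    using U0_fin U2_fin[of t] by (intro integrableI_nonneg) auto
  define C where "C = (\<integral>\<omega>. (U 0 \<omega>)\<^sup>2 \<partial>P)"
  have C: "(\<integral>\<omega>. (U t \<omega>)\<^sup>2 \<partial>P) = C" for t
    unfolding C_def using U2_fin[of t] by (simp add: integral_eq_nn_integral)

  \<comment> \<open>The limit of the integrals over the past, with witness
    \<open>U 0\<close>\<close>
  have "L2_tendsto P (\<lambda>a. ibp_integral (\<lambda>s. exp (lam * s)) M a 0) (U 0) at_bot"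
    unfolding L2_tendsto_def
  proof (intro conjI)
    have I: "AE \<omega> in P. ibp_integral (\<lambda>s. exp (lam * s)) M a 0 \<omega> = U 0 \<omega> - exp (lam * a) * U a \<omega>" if "a \<le> 0" for a
      using flow[OF that] by eventually_elim simp
    show "sq_integrable P (U 0)"
      using U2 by (simp add: sq_integrable_def)
    have "sq_integrable P (ibp_integral (\<lambda>s. exp (lam * s)) M a 0)" if a: "a \<le> 0" for a
      unfolding sq_integrable_def
    proof
      have "integrable P (\<lambda>\<omega>. 2 * (U 0 \<omega>)\<^sup>2 + 2 * (exp (lam * a) * U a \<omega>)\<^sup>2)"
        using U2 by (simp add: power_mult_distrib)
      then show "integrable P (\<lambda>\<omega>. (ibp_integral (\<lambda>s. exp (lam * s)) M a 0 \<omega>)\<^sup>2)"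
      proof (rule Bochner_Integration.integrable_bound)
        have sq: "(x - y)\<^sup>2 \<le> 2 * x\<^sup>2 + 2 * y\<^sup>2" for x y :: real
          using zero_le_power2[of "x + y"] by (simp add: power2_eq_square algebra_simps)
        show "AE \<omega> in P. norm ((ibp_integral (\<lambda>s. exp (lam * s)) M a 0 \<omega>)\<^sup>2) \<le>
            norm (2 * (U 0 \<omega>)\<^sup>2 + 2 * (exp (lam * a) * U a \<omega>)\<^sup>2)"
          using I[OF a] by eventually_elim (use sq in simp)
      qed (use a in measurable)
    qed (use a in measurable)
    then show "\<forall>\<^sub>F a in at_bot. sq_integrable P (ibp_integral (\<lambda>s. exp (lam * s)) M a 0)"
      by (auto simp: eventually_at_bot_linorder)
    \<comment> \<open>The error is almost surely \<open>- exp (lam * a) * U a\<close>. By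
      stationarity its second moment is known exactly and depends on \<open>a\<close> only through
      the exponential.\<close>
    have "(\<integral>\<omega>. (ibp_integral (\<lambda>s. exp (lam * s)) M a 0 \<omega> - U 0 \<omega>)\<^sup>2 \<partial>P) = (exp (lam * a))\<^sup>2 * C" if a: "a \<le> 0" for a
    proof -
      have "(\<integral>\<omega>. (ibp_integral (\<lambda>s. exp (lam * s)) M a 0 \<omega> - U 0 \<omega>)\<^sup>2 \<partial>P) =
          (\<integral>\<omega>. (exp (lam * a))\<^sup>2 * (U a \<omega>)\<^sup>2 \<partial>P)"
      proof (rule integral_cong_AE)
        show "AE \<omega> in P. (ibp_integral (\<lambda>s. exp (lam * s)) M a 0 \<omega> - U 0 \<omega>)\<^sup>2 = (exp (lam * a))\<^sup>2 * (U a \<omega>)\<^sup>2"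
          using I[OF a] by eventually_elim (simp add: power_mult_distrib)
      qed (use a in measurable)
      then show ?thesis by (simp add: C)
    qed
    then have "\<forall>\<^sub>F a in at_bot. (exp (lam * a))\<^sup>2 * C =
        (\<integral>\<omega>. (ibp_integral (\<lambda>s. exp (lam * s)) M a 0 \<omega> - U 0 \<omega>)\<^sup>2 \<partial>P)"
      by (auto simp: eventually_at_bot_linorder intro!: exI[of _ 0])
    moreover have "((\<lambda>a. (exp (lam * a))\<^sup>2 * C) \<longlongrightarrow> 0\<^sup>2 * C) at_bot"
    proof -
      have "filterlim (\<lambda>a. lam * a) at_bot at_bot"
        using lam by (intro filterlim_tendsto_pos_mult_at_bot[OF tendsto_const]) (auto simp: filterlim_ident)
      then have "((\<lambda>a. exp (lam * a)) \<longlongrightarrow> 0) at_bot"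
        by (rule filterlim_compose[OF exp_at_bot])
      then show ?thesis by (intro tendsto_intros)
    qed
    ultimately show "((\<lambda>a. \<integral>\<omega>. (ibp_integral (\<lambda>s. exp (lam * s)) M a 0 \<omega> - U 0 \<omega>)\<^sup>2 \<partial>P) \<longlongrightarrow> 0) at_bot"
      using tendsto_cong by force
  qed

  \<comment> \<open>The representation on the product of sample space and time interval\<close>
  moreover have "L2_eq (time_product P T) (\<lambda>(\<omega>, t). U t \<omega>)
      (\<lambda>(\<omega>, t). exp (- lam * t) * U 0 \<omega> + ibp_integral (\<lambda>s. exp (- lam * (t - s))) M 0 t \<omega>)" if T: "T > 0" for T
  proof -
    define R where "R = restrict_space lborel {0..T}"
    interpret R: finite_measure R
      unfolding R_def using T by (intro finite_measureI) (simp add: space_restrict_space emeasure_restrict_space)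
    interpret pair_sigma_finite P R ..
    have space_R: "space R = {0..T}"
      by (simp add: R_def space_restrict_space)
    have [measurable]: "(\<lambda>t. t) \<in> borel_measurable R"
      unfolding R_def by (intro measurable_restrict_space1) simp
    define V where "V t \<omega> = exp (- lam * t) * U 0 \<omega> + ibp_integral (\<lambda>s. exp (- lam * (t - s))) M 0 t \<omega>" for t \<omega>
    have [measurable]: "(\<lambda>(\<omega>, t). U t \<omega>) \<in> borel_measurable (P \<Otimes>\<^sub>M borel)"
      using U by (simp add: measurable_process_def)
    have [measurable]: "(\<lambda>x. U (snd x) (fst x)) \<in> borel_measurable (P \<Otimes>\<^sub>M R)"
      by measurable
    have "(\<lambda>x. ibp_integral (\<lambda>s. exp (lam * s)) M 0 (snd x) (fst x)) \<in> borel_measurable (P \<Otimes>\<^sub>M R)"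
      by (rule measurable_ibp_integral_exp[OF M]) (auto simp: space_pair_measure space_R)
    then have [measurable]: "(\<lambda>x. V (snd x) (fst x)) \<in> borel_measurable (P \<Otimes>\<^sub>M R)"
      unfolding V_def ibp_integral_exp_shift by measurable
    \<comment> \<open>The null set depends on \<open>t\<close>. Joint measurability of both sides
      then lets Fubini replace these null sets by a single one in the product space.\<close>
    have "AE \<omega> in P. U t \<omega> = V t \<omega>" if "t \<in> space R" for t
    proof -
      have "AE \<omega> in P. exp (lam * t) * U t \<omega> = U 0 \<omega> + ibp_integral (\<lambda>r. exp (lam * r)) M 0 t \<omega>"
        using flow[of 0 t] that by (simp add: space_R)
      then show ?thesis
      proof eventually_elim
        case (elim \<omega>)
        have "U t \<omega> = exp (- lam * t) * (exp (lam * t) * U t \<omega>)"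
          by (simp add: exp_minus)
        also have "\<dots> = V t \<omega>"
          unfolding elim V_def ibp_integral_exp_shift by (simp add: distrib_left)
        finally show ?case .
      qed
    qed
    then have "AE t in R. AE \<omega> in P. U t \<omega> = V t \<omega>"
      by (rule AE_I2)
    moreover have sets: "{x \<in> space (P \<Otimes>\<^sub>M R). U (snd x) (fst x) = V (snd x) (fst x)} \<in> sets (P \<Otimes>\<^sub>M R)"
      by measurable
    ultimately have eq: "AE x in P \<Otimes>\<^sub>M R. U (snd x) (fst x) = V (snd x) (fst x)"
      using AE_commute[OF sets] AE_pair_iff[OF sets] by simp
    \<comment> \<open>Stationarity makes the inner integral constant in \<open>t\<close>, so the
      total is a finite constant times the finite mass of \<open>R\<close>.\<close>
    have "(\<integral>\<^sup>+x. ennreal ((U (snd x) (fst x))\<^sup>2) \<partial>(P \<Otimes>\<^sub>M R)) = (\<integral>\<^sup>+t. (\<integral>\<^sup>+\<omega>. ennreal ((U t \<omega>)\<^sup>2) \<partial>P) \<partial>R)"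
      by (subst nn_integral_snd[symmetric]) auto
    also have "\<dots> = (\<integral>\<^sup>+t. (\<integral>\<^sup>+\<omega>. ennreal ((U 0 \<omega>)\<^sup>2) \<partial>P) \<partial>R)"
      by (intro nn_integral_cong U2_fin)
    also have "\<dots> < \<infinity>"
      using U0_fin R.emeasure_finite[of "space R", THEN top.not_eq_extremum[THEN iffD1]]
      by (simp add: ennreal_mult_less_top)
    finally have "integrable (P \<Otimes>\<^sub>M R) (\<lambda>x. (U (snd x) (fst x))\<^sup>2)"
      by (intro integrableI_nonneg) auto
    \<comment> \<open>Square integrability of \<open>V\<close> is inherited from \<open>U\<close>
      through the almost-everywhere equality; the integral in \<open>V\<close> is not estimated
      directly.\<close>
    moreover from this have "integrable (P \<Otimes>\<^sub>M R) (\<lambda>x. (V (snd x) (fst x))\<^sup>2)"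
      by (rule integrable_cong_AE_imp) (use eq in \<open>auto elim: eventually_mono\<close>)
    ultimately have "L2_eq (P \<Otimes>\<^sub>M R) (\<lambda>x. U (snd x) (fst x)) (\<lambda>x. V (snd x) (fst x))"
      using eq by (simp add: L2_eq_def sq_integrable_def)
    then show ?thesis
      by (simp add: R_def V_def case_prod_beta')
  qed
  ultimately show ?thesis by blast
qed

end
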